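(* Let $p,n$ be positive integers with $6\le n\le 10$ and $p\ge n$, and let $r\in\{0,1,\ldots,n-2\}$ be given by $p\equiv r\pmod{n-1}$. (i) If $n\in\{6,7\}$, then $ex(p;T_n^* )=\frac{(n-2)p-r(n-1-r)}{2}$. (ii) If $n\in\{8,9\}$, then $$ex(p;T_n^* )=\begin{cases}\frac{(n-2)p-r(n-1-r)}{2} & \text{if } r\ne n-5,\\[4pt] \frac{(n-2)(p-2)}{2}+1 & \text{if } r=n-5.\end{cases}$$ (iii) If $n=10$, then $$ex(p;T_n^* )=\begin{cases}4p-\frac{r(9-r)}{2} & \text{if } r\ne 4,5,\\ 4p-7 & \text{if } r=5,\\ 4p-9 & \text{if } r=4.\end{cases}$$
   Context: All graphs are finite simple graphs. For $n\ge 4$, $T_n^*$ denotes the tree on the $n$ vertices $v_0,v_1,\ldots,v_{n-1}$ with edge set $\{v_0v_1,\ldots,v_0v_{n-3},\,v_{n-3}v_{n-2},\,v_{n-2}v_{n-1}\}$. For a graph $L$, $ex(p;L)$ denotes the maximal number of edges in a graph on $p$ vertices that does not contain $L$ as a (not necessarily induced) subgraph. *)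

theory Defs
  imports Complex_Main "HOL-Library.Ramsey" "HOL-Number_Theory.Cong"
begin

text \<open>A graph is a pair \<open>(V, E)\<close> of a vertex set and a set of edges, each edge being a
  two-element subset of \<open>V\<close>.\<close>

type_synonym 'a graph = "'a set \<times> 'a set set"

definition verts :: "'a graph \<Rightarrow> 'a set" where
  "verts G = fst G"

definition edges :: "'a graph \<Rightarrow> 'a set set" where
  "edges G = snd G"

definition simple_graph :: "'a graph \<Rightarrow> bool" where
  "simple_graph G \<longleftrightarrow> finite (verts G) \<and> edges G \<subseteq> nsets (verts G) 2"

definition contains_subgraph :: "'a graph \<Rightarrow> 'b graph \<Rightarrow> bool" where
  "contains_subgraph G L \<longleftrightarrow>
     (\<exists>f. inj_on f (verts L) \<and> f ` verts L \<subseteq> verts G \<and> (\<forall>e\<in>edges L. f ` e \<in> edges G))"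

text \<open>Every finite graph is isomorphic to one whose vertices are natural numbers, so it is no
  restriction to let \<open>G\<close> range over such graphs. The maximum is over a finite set, which is nonempty
  as soon as \<open>L\<close> has an edge (see below).\<close>

definition turan_number :: "nat \<Rightarrow> 'a graph \<Rightarrow> nat" where
  "turan_number p L =
     Max {card (edges G) | G :: nat graph.
            simple_graph G \<and> card (verts G) = p \<and> \<not> contains_subgraph G L}"

text \<open>The vertex \<open>v\<^sub>i\<close> is the number \<open>i\<close>; meant for \<open>n \<ge> 4\<close>, so that the subtractions
  do not truncate.\<close>

definition T_star :: "nat \<Rightarrow> nat graph" where
  "T_star n = ({0..<n},
     {{0, i} | i. 1 \<le> i \<and> i \<le> n - 3} \<union> {{n - 3, n - 2}, {n - 2, n - 1}})"

lemma simple_graph_T_star: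
  assumes "n \<ge> 4"
  shows "simple_graph (T_star n)"
  using assms by (auto simp: simple_graph_def T_star_def verts_def edges_def nsets_def)

lemma finite_turan_set:
  "finite {card (edges G) | G :: nat graph.
            simple_graph G \<and> card (verts G) = p \<and> \<not> contains_subgraph G L}"
proof (rule finite_subset)
  show "{card (edges G) | G :: nat graph.
      simple_graph G \<and> card (verts G) = p \<and> \<not> contains_subgraph G L} \<subseteq> {..p choose 2}"
  proof clarsimp
    fix V :: "nat set" and E
    assume "simple_graph (V, E)" "p = card (verts (V, E))"
    then show "card (edges (V, E)) \<le> card (verts (V, E)) choose 2"
      unfolding simple_graph_def
      by (metis card_mono card_nsets finite_imp_finite_nsets)
  qed
qed simp

lemma turan_set_nonempty:
  assumes "edges L \<noteq> {}"
  shows "{card (edges G) | G :: nat graph.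
            simple_graph G \<and> card (verts G) = p \<and> \<not> contains_subgraph G L} \<noteq> {}"
proof -
  let ?G = "({0..<p}, {}) :: nat graph"
  have "simple_graph ?G \<and> card (verts ?G) = p \<and> \<not> contains_subgraph ?G L"
    using assms by (auto simp: simple_graph_def verts_def edges_def contains_subgraph_def)
  then show ?thesis by blast
qed

end

theory Submission
  imports Defs
begin

text \<open>A copy of the tree is a vertex \<open>v\<close> with a path \<open>v a b c\<close> and at least \<open>n - 4\<close> further neighbours.
  For a connected graph on \<open>m \<ge> n\<close> vertices that contains none, look at the maximal degree.
  A vertex of degree at least \<open>n - 2\<close> leaves almost no room for edges away from it, so the graph is
  sparse; maximal degree at most \<open>n - 4\<close> suffices because \<open>n \<le> 10\<close>.
  In the critical case of maximal degree \<open>n - 3\<close>, the non-neighbours of every vertex of degree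
  \<open>n - 3\<close> form an independent set. This bounds the number of edges by \<open>(n - 3)\<^sup>2\<close>, and for
  \<open>m < 2 n - 6\<close> two adjacent vertices of degree \<open>n - 3\<close> give two independent sets
  of equal size whose overlap forces enough degree deficiency.
  The resulting bound is superadditive in \<open>p\<close>, so it passes to disconnected graphs.\<close>

text \<open>The number of edges is \<open>((n - 2) p - loss n r) / 2\<close>. Disjoint copies of \<open>K\<^bsub>n-1\<^esub>\<close> and
  one \<open>K\<^sub>r\<close> give the product; the exceptional values come from \<open>K\<^bsub>n-3,n-3\<^esub>\<close> and, for
  \<open>n = 10\<close> and \<open>r = 4\<close>, from \<open>K\<^bsub>7,6\<^esub>\<close> with an edge added on the side of size 7.\<close>

definition loss :: "nat \<Rightarrow> nat \<Rightarrow> nat" where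
  "loss n r = (if n \<in> {8, 9} \<and> r = n - 5 then 2 * n - 6
     else if n = 10 \<and> r = 5 then 14
     else if n = 10 \<and> r = 4 then 18
     else r * (n - 1 - r))"

text \<open>For \<open>p < n\<close> the complete graph is extremal, so the exceptional values must be excluded there.\<close>

definition gap :: "nat \<Rightarrow> nat \<Rightarrow> nat" where
  "gap n p = (if p < n then p * (n - 1 - p) else loss n (p mod (n - 1)))"

section \<open>Arithmetic of the degree deficit\<close>

lemma loss_le_product: "6 \<le> n \<Longrightarrow> n \<le> 10 \<Longrightarrow> loss n r \<le> r * (n - 1 - r)"
proof -
  assume "6 \<le> n" "n \<le> 10"
  then have "n = 6 \<or> n = 7 \<or> n = 8 \<or> n = 9 \<or> n = 10" by linarith
  then show ?thesis by (auto simp: loss_def)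
qed

text \<open>Finite check. The constant 3 * (n - 4) is the value of \<open>loss n\<close> at n - 4,
  hence its maximum over residues. The second part is what keeps a union of components from beating
  the bound.\<close>

lemma loss_table:
  "\<forall>n \<in> set [6..<11]. \<forall>a \<in> set [0..<n - 1]. loss n a \<le> 3 * (n - 4) \<and>
     (\<forall>b \<in> set [0..<n - 1]. loss n ((a + b) mod (n - 1)) \<le> loss n a + loss n b)"
  by code_simp

lemma loss_le: "6 \<le> n \<Longrightarrow> n \<le> 10 \<Longrightarrow> a < n - 1 \<Longrightarrow> loss n a \<le> 3 * (n - 4)"
  using loss_table unfolding set_upt by simp

lemma loss_add:
  assumes "6 \<le> n" "n \<le> 10" "a < n - 1" "b < n - 1"
  shows "loss n ((a + b) mod (n - 1)) \<le> loss n a + loss n b"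
  using loss_table assms unfolding set_upt by simp

lemma loss_le_gap:
  assumes "6 \<le> n" "n \<le> 10"
  shows "loss n (p mod (n - 1)) \<le> gap n p"
proof (cases "p < n - 1")
  case True
  then show ?thesis using loss_le_product[OF assms] by (simp add: gap_def)
next
  case False
  then consider "p = n - 1" | "p \<ge> n" using assms by linarith
  then show ?thesis
    by cases (use assms in \<open>auto simp: gap_def loss_def\<close>)
qed

lemma gap_le:
  assumes "6 \<le> n" "n \<le> 10" "n \<le> p"
  shows "gap n p \<le> 3 * (n - 4)"
  using assms loss_le[of n "p mod (n - 1)"] by (auto simp: gap_def)

text \<open>This lets the bound pass to disjoint unions. While a + b < n, replacing a + b by a or by
  b in the second factor only enlarges it. Otherwise the left side is a \<open>loss\<close>, which
  is subadditive on residues and bounded by \<open>gap\<close>.\<close>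

lemma gap_add:
  assumes "6 \<le> n" "n \<le> 10"
  shows "gap n (a + b) \<le> gap n a + gap n b"
proof (cases "a + b < n")
  case True
  have "(a + b) * (n - 1 - (a + b)) \<le> a * (n - 1 - a) + b * (n - 1 - b)"
    unfolding add_mult_distrib by (intro add_mono mult_le_mono) auto
  with True show ?thesis by (simp add: gap_def)
next
  case False
  have "loss n ((a + b) mod (n - 1)) = loss n ((a mod (n - 1) + b mod (n - 1)) mod (n - 1))"
    by (simp add: mod_add_eq)
  also have "\<dots> \<le> loss n (a mod (n - 1)) + loss n (b mod (n - 1))"
    using assms by (intro loss_add) auto
  also have "\<dots> \<le> gap n a + gap n b"
    using assms by (intro add_mono loss_le_gap)
  finally show ?thesis using False by (simp add: gap_def)
qed

text \<open>Here n - 3 + s is the number of vertices, so s - 2 is its residue modulo n - 1; t is the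
  overlap of two independent sets of size s, and n - 3 - s + t counts common neighbours. The first
  two disjuncts correspond to the two bounds of \<open>sum_le_overlap\<close>. One triple escapes
  both and gets its own argument.\<close>

lemma overlap_table:
  "\<forall>n \<in> set [6..<11]. \<forall>s \<in> set [3..<n - 3]. \<forall>t \<in> set [0..<s].
     t * (n - 3 - s + t) + (n - 3 + s - t) * (n - 3) + loss n (s - 2) \<le> (n - 2) * (n - 3 + s) \<or>
     2 * (s - t) * (s - t) + 2 * (n - 3 - s + t) * (n - 3) + loss n (s - 2) \<le> (n - 2) * (n - 3 + s) \<or>
     n = 10 \<and> s = 5 \<and> t = 4"
  by code_simp

text \<open>For the case that no neighbour of a vertex of degree n - 3 has degree n - 3
  itself.\<close>

lemma no_adjacent_pair_table:
  "\<forall>n \<in> set [6..<11]. \<forall>s \<in> set [3..<n - 3].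
     (n - 3) * (n - 4) + s * (n - 3) + loss n (s - 2) \<le> (n - 2) * (n - 3 + s)"
  by code_simp

section \<open>Upper bound\<close>

locale spider_free =
  fixes N :: "'a \<Rightarrow> 'a set" and n :: nat
  assumes nbr_sym: "u \<in> N v \<Longrightarrow> v \<in> N u"
    and nbr_irrefl: "v \<notin> N v"
    and no_spider: "\<lbrakk>a \<in> N v; b \<in> N a; c \<in> N b; b \<noteq> v; c \<noteq> v; c \<noteq> a\<rbrakk>
                      \<Longrightarrow> card (N v - {a, b, c}) < n - 4"
    and n_ge: "6 \<le> n" and n_le: "n \<le> 10"
begin

definition nbr_closed :: "'a set \<Rightarrow> bool" where
  "nbr_closed V \<longleftrightarrow> finite V \<and> (\<forall>v\<in>V. N v \<subseteq> V)"

text \<open>Connectedness without walks: apart from the empty set, these are the minimal nonempty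
  closed sets, that is, the finite components.\<close>

definition nbr_connected :: "'a set \<Rightarrow> bool" where
  "nbr_connected V \<longleftrightarrow> nbr_closed V \<and> (\<forall>C \<subseteq> V. C \<noteq> {} \<longrightarrow> nbr_closed C \<longrightarrow> C = V)"

lemma finite_nbr: "nbr_closed V \<Longrightarrow> v \<in> V \<Longrightarrow> finite (N v)"
  by (meson finite_subset nbr_closed_def)

lemma sum_card_swap:
  assumes "finite A" "finite B"
  shows "(\<Sum>x\<in>A. card (N x \<inter> B)) = (\<Sum>y\<in>B. card (N y \<inter> A))"
proof -
  have *: "card (N x \<inter> B) = (\<Sum>y\<in>B. if y \<in> N x then 1 else 0)" if "finite B" for x B
    using that by (simp add: sum.If_cases Int_commute)
  have "(\<Sum>x\<in>A. card (N x \<inter> B)) = (\<Sum>y\<in>B. \<Sum>x\<in>A. if y \<in> N x then 1 else 0)"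
    by (simp add: * assms sum.swap[of _ A])
  also have "\<dots> = (\<Sum>y\<in>B. card (N y \<inter> A))"
    by (auto simp: * assms intro!: sum.cong dest: nbr_sym)
  finally show ?thesis .
qed

lemma sum_card_le:
  assumes "\<And>x. x \<in> A \<Longrightarrow> card (N x) \<le> k"
  shows "(\<Sum>x\<in>A. card (N x)) \<le> card A * k"
  using sum_bounded_above[of A "\<lambda>x. card (N x)" k] assms by simp

text \<open>By the last hypothesis no edge leaves the ball of radius two around v, so the ball is
  closed and by connectedness is everything.\<close>

lemma connected_reach:
  assumes "nbr_connected V" "v \<in> V" "y \<in> V"
    and "\<And>a x. a \<in> N v \<Longrightarrow> x \<in> N a \<Longrightarrow> x \<notin> insert v (N v) \<Longrightarrow> N x \<subseteq> N v"
  shows "y = v \<or> y \<in> N v \<or> (\<exists>a\<in>N v. y \<in> N a)"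
proof -
  let ?W = "insert v (N v) \<union> (\<Union>a\<in>N v. N a)"
  have "?W \<subseteq> V" using assms(1,2) by (auto simp: nbr_connected_def nbr_closed_def)
  moreover have "\<forall>x\<in>?W. N x \<subseteq> ?W" using assms(4) by blast
  ultimately have "nbr_closed ?W"
    using assms(1) by (auto simp: nbr_connected_def nbr_closed_def intro: finite_subset)
  with \<open>?W \<subseteq> V\<close> assms(1) have "?W = V"
    unfolding nbr_connected_def by blast
  with assms(3) have "y \<in> ?W" by simp
  then show ?thesis by blast
qed

section \<open>Vertices of degree at least n - 2\<close>

text \<open>Any three vertices may be removed from N v and n - 4 remain, so no path with three edges
  starts at v. Hence the graph without v is a star forest, with degree sum at most 2 * card V - 4,
  and restoring v adds 2 * card (N v), at most 2 * card V - 2.\<close>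

lemma sum_le_of_large_degree:
  assumes V: "nbr_connected V" "v \<in> V" and d: "n - 1 \<le> card (N v)"
  shows "(\<Sum>x\<in>V. card (N x)) + 6 \<le> 4 * card V"
proof -
  have cl: "nbr_closed V" and fin: "finite V"
    using V by (auto simp: nbr_connected_def nbr_closed_def)
  define M where "M x = N x - {v}" for x
  have path: "N b \<subseteq> {v, a}" if "a \<in> N v" "b \<in> N a" "b \<noteq> v" for a b
  proof (rule ccontr)
    assume "\<not> ?thesis"
    then obtain c where c: "c \<in> N b" "c \<noteq> v" "c \<noteq> a" by auto
    have "card (N v) - card {a, b, c} \<le> card (N v - {a, b, c})"
      by (rule diff_card_le_card_Diff) simp
    moreover have "card {a, b, c} \<le> 3" by (simp add: card_insert_if)
    ultimately show False using no_spider[OF that(1,2) c(1) that(3) c(2,3)] d n_ge by linarith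
  qed
  have reach: "y = v \<or> y \<in> N v \<or> (\<exists>a\<in>N v. y \<in> N a)" if "y \<in> V" for y
  proof (rule connected_reach[OF V that])
    fix a x assume "a \<in> N v" "x \<in> N a" "x \<notin> insert v (N v)"
    then show "N x \<subseteq> N v" using path[of a x] nbr_sym by blast
  qed
  define L where "L = {x \<in> V - {v}. card (M x) = 1}"
  \<comment> \<open>Every edge of the graph without \<open>v\<close> has an end of degree 1, so there are at most as many edges
    as such vertices.\<close>
  have leaf: "card (M x) = 1 \<or> card (M y) = 1" if "x \<in> V - {v}" "y \<in> M x" for x y
  proof -
    have *: "card (M b) = 1" if "a \<in> N v" "b \<in> M a" for a b
    proof -
      have "M b = {a}"
        using path[of a b] that nbr_sym[of b a] nbr_irrefl[of v] by (auto simp: M_def)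
      then show ?thesis by simp
    qed
    show ?thesis
    proof (cases "x \<in> N v")
      case True
      then show ?thesis using * that by blast
    next
      case False
      then obtain a where "a \<in> N v" "x \<in> N a" using reach[of x] \<open>x \<in> V - {v}\<close> by blast
      then show ?thesis using *[of a x] that by (auto simp: M_def)
    qed
  qed
  have finM: "finite (M x)" if "x \<in> V" for x
    using finite_nbr[OF cl that] by (simp add: M_def)
  have swap: "(\<Sum>x\<in>V - {v}. card (M x \<inter> B)) = (\<Sum>y\<in>B. card (M y))" if "B \<subseteq> V - {v}" for B
  proof -
    have "(\<Sum>x\<in>V - {v}. card (M x \<inter> B)) = (\<Sum>x\<in>V - {v}. card (N x \<inter> B))"
      using that by (intro sum.cong arg_cong[of _ _ card]) (auto simp: M_def)
    also have "\<dots> = (\<Sum>y\<in>B. card (N y \<inter> (V - {v})))"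
      using that fin by (intro sum_card_swap) (auto intro: finite_subset)
    also have "\<dots> = (\<Sum>y\<in>B. card (M y))"
      using that cl by (intro sum.cong arg_cong[of _ _ card]) (auto simp: M_def nbr_closed_def)
    finally show ?thesis .
  qed
  have L: "L \<subseteq> V - {v}" "finite L" and sumL: "(\<Sum>x\<in>L. card (M x)) = card L"
    using fin by (auto simp: L_def)
  have "card (M x) \<le> (if x \<in> L then card (M x) else 0) + card (M x \<inter> L)" if "x \<in> V - {v}" for x
  proof (cases "x \<in> L")
    case False
    then have "M x \<subseteq> L"
      using leaf[OF that] that cl by (auto simp: L_def M_def nbr_closed_def)
    then show ?thesis using False by (simp add: Int_absorb2)
  qed auto
  then have "(\<Sum>x\<in>V - {v}. card (M x))
      \<le> (\<Sum>x\<in>V - {v}. (if x \<in> L then card (M x) else 0) + card (M x \<inter> L))"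
    by (intro sum_mono)
  also have "\<dots> = (\<Sum>x\<in>L. card (M x)) + (\<Sum>y\<in>L. card (M y))"
    using L fin by (simp add: sum.distrib swap sum.If_cases Int_absorb1)
  finally have le: "(\<Sum>x\<in>V - {v}. card (M x)) \<le> 2 * card L" by (simp add: sumL)
  have cardV: "card (V - {v}) = card V - 1" using V(2) fin by simp
  have NV: "N v \<subseteq> V - {v}" using cl V(2) nbr_irrefl by (auto simp: nbr_closed_def)
  then have dV: "card (N v) \<le> card V - 1" using cardV fin by (metis card_mono finite_Diff)
  have "(\<Sum>x\<in>V - {v}. card (M x)) + 4 \<le> 2 * card V"
  \<comment> \<open>If all vertices other than v are leaves, the graph without v is a perfect
    matching. Otherwise \<open>L\<close> misses one of them, which lowers the bound 2 * card L by
    the required amount.\<close>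
  proof (cases "L = V - {v}")
    case True
    then have "(\<Sum>x\<in>V - {v}. card (M x)) = card V - 1" using sumL cardV by simp
    then show ?thesis using dV d n_ge by linarith
  next
    case False
    then have "card L < card V - 1" using L fin cardV by (metis finite_Diff psubset_card_mono psubsetI)
    then show ?thesis using le by linarith
  qed
  moreover have "(\<Sum>x\<in>V - {v}. card (N x)) = (\<Sum>x\<in>V - {v}. card (M x)) + card (N v)"
  proof -
    have "card (N x) = card (M x) + card (N x \<inter> {v})" if "x \<in> V" for x
      unfolding M_def using finite_nbr[OF cl that]
      using card_Int_Diff[of "N x" "{v}"] by simp
    then have "(\<Sum>x\<in>V - {v}. card (N x)) = (\<Sum>x\<in>V - {v}. card (M x)) + (\<Sum>x\<in>V - {v}. card (N x \<inter> {v}))"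
      by (simp add: sum.distrib)
    also have "(\<Sum>x\<in>V - {v}. card (N x \<inter> {v})) = card (N v)"
      using sum_card_swap[of "V - {v}" "{v}"] fin NV by (simp add: Int_absorb2)
    finally show ?thesis .
  qed
  moreover have "(\<Sum>x\<in>V. card (N x)) = card (N v) + (\<Sum>x\<in>V - {v}. card (N x))"
    using fin V(2) by (simp add: sum.remove)
  ultimately show ?thesis using dV d n_ge by linarith
qed

text \<open>Now two vertices may be removed from N v, so every path v a b c has b and c in N v.
  Vertices outside v and N v are therefore pendant, and since card V is at least n there is one. Its
  neighbour is isolated within N v, which saves inner edges.\<close>

lemma sum_le_of_degree_n_minus_2:
  assumes V: "nbr_connected V" "v \<in> V" and d: "card (N v) = n - 2" and m: "n \<le> card V"
  shows "(\<Sum>x\<in>V. card (N x)) + 2 \<le> 2 * card V + (n - 3) * (n - 4)"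
proof -
  have cl: "nbr_closed V" and fin: "finite V" and NV: "N v \<subseteq> V" and finN: "finite (N v)"
    using V finite_nbr by (auto simp: nbr_connected_def nbr_closed_def)
  have path: "b \<in> N v \<and> c \<in> N v"
    if "a \<in> N v" "b \<in> N a" "c \<in> N b" "b \<noteq> v" "c \<noteq> v" "c \<noteq> a" for a b c
  proof (rule ccontr)
    assume "\<not> ?thesis"
    then obtain y where "N v - {a, b, c} = N v - {a, y}" by blast
    moreover have "card (N v) - card {a, y} \<le> card (N v - {a, y})"
      by (rule diff_card_le_card_Diff) simp
    moreover have "card {a, y} \<le> 2" by (simp add: card_insert_if)
    ultimately have "n - 4 \<le> card (N v - {a, b, c})" using d by simp
    then show False using no_spider[OF that] n_ge by linarith
  qed
  have pend: "N x = {a}" if "a \<in> N v" "x \<in> N a" "x \<notin> insert v (N v)" for a x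
  proof -
    have "v \<notin> N x" "a \<in> N x" using that nbr_sym by blast+
    moreover have "y = a" if "y \<in> N x" for y
      using path[of a x y] \<open>a \<in> N v\<close> \<open>x \<in> N a\<close> \<open>x \<notin> insert v (N v)\<close> \<open>v \<notin> N x\<close> that by blast
    ultimately show ?thesis by blast
  qed
  have reach: "y = v \<or> y \<in> N v \<or> (\<exists>a\<in>N v. y \<in> N a)" if "y \<in> V" for y
  proof (rule connected_reach[OF V that])
    fix a x assume "a \<in> N v" "x \<in> N a" "x \<notin> insert v (N v)"
    then show "N x \<subseteq> N v" using pend[of a x] by simp
  qed
  define R where "R = V - insert v (N v)"
  have finR: "finite R" using fin by (simp add: R_def)
  have cardR: "card R = card V - (n - 1)"
    using NV V(2) fin finN nbr_irrefl d n_ge by (simp add: R_def card_Diff_subset)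
  then have "R \<noteq> {}" using m n_ge by auto
  then obtain x0 where x0: "x0 \<in> R" by blast
  then obtain a0 where a0: "a0 \<in> N v" "x0 \<in> N a0"
    using reach[of x0] unfolding R_def by blast
  \<comment> \<open>A common vertex a would give the path v a a0 x0 ending outside N v. So only n -
    3 vertices of N v can carry edges inside N v.\<close>
  have a0N: "N a0 \<inter> N v = {}"
  proof (rule ccontr)
    assume "\<not> ?thesis"
    then obtain a where a: "a \<in> N a0" "a \<in> N v" by blast
    have "a0 \<noteq> v" "x0 \<noteq> v" "x0 \<noteq> a" using a a0 x0 nbr_irrefl by (auto simp: R_def)
    with a a0 have "x0 \<in> N v" using path[of a a0 x0] nbr_sym by blast
    then show False using x0 by (simp add: R_def)
  qed
  have R1: "card (N x) = 1" if "x \<in> R" for x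
  proof -
    obtain a where "N x = {a}"
      using pend reach[of x] \<open>x \<in> R\<close> unfolding R_def by blast
    then show ?thesis by simp
  qed
  have inner: "(\<Sum>y\<in>N v. card (N y \<inter> N v)) \<le> (n - 3) * (n - 4)"
  proof -
    have "card (N y \<inter> N v) \<le> n - 4" if "y \<in> N v - {a0}" for y
    proof -
      have "a0 \<notin> N y" using a0N that nbr_sym by blast
      then have "N y \<inter> N v \<subseteq> N v - {a0, y}" using nbr_irrefl by blast
      moreover have "card (N v - {a0, y}) = n - 4"
        using that a0 d finN n_ge by (auto simp: card_Diff_subset)
      ultimately show ?thesis using finN by (metis card_mono finite_Diff)
    qed
    then have "(\<Sum>y\<in>N v - {a0}. card (N y \<inter> N v)) \<le> card (N v - {a0}) * (n - 4)"
      using sum_bounded_above[of "N v - {a0}" "\<lambda>y. card (N y \<inter> N v)" "n - 4"] by simp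
    then show ?thesis using a0 d finN a0N by (simp add: sum.remove)
  qed
  have "card (N y) \<le> 1 + card (N y \<inter> N v) + card (N y \<inter> R)" if "y \<in> N v" for y
  proof -
    have "N y \<subseteq> {v} \<union> (N y \<inter> N v) \<union> (N y \<inter> R)"
      using that NV cl by (auto simp: R_def nbr_closed_def)
    then have "card (N y) \<le> card ({v} \<union> (N y \<inter> N v) \<union> (N y \<inter> R))"
      using finN finR by (intro card_mono) auto
    also have "\<dots> \<le> card {v} + card (N y \<inter> N v) + card (N y \<inter> R)"
      by (intro order_trans[OF card_Un_le] add_right_mono card_Un_le)
    finally show ?thesis by simp
  qed
  then have "(\<Sum>y\<in>N v. card (N y)) \<le> (\<Sum>y\<in>N v. 1 + card (N y \<inter> N v) + card (N y \<inter> R))"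
    by (intro sum_mono)
  also have "\<dots> = (n - 2) + (\<Sum>y\<in>N v. card (N y \<inter> N v)) + (\<Sum>x\<in>R. card (N x \<inter> N v))"
    by (simp only: sum.distrib sum_card_swap[OF finN finR]) (simp add: d)
  also have "(\<Sum>x\<in>R. card (N x \<inter> N v)) \<le> (\<Sum>x\<in>R. 1)"
  proof (intro sum_mono)
    fix x assume "x \<in> R"
    then show "card (N x \<inter> N v) \<le> 1"
      using R1[of x] card_mono[of "N x" "N x \<inter> N v"] finite_nbr[OF cl, of x] by (simp add: R_def)
  qed
  finally have "(\<Sum>y\<in>N v. card (N y)) \<le> (n - 2) + (n - 3) * (n - 4) + card R"
    using inner by simp
  moreover have "(\<Sum>x\<in>R. card (N x)) = card R" using R1 by simp
  moreover have "(\<Sum>x\<in>V. card (N x)) = (\<Sum>x\<in>R. card (N x)) + (card (N v) + (\<Sum>y\<in>N v. card (N y)))"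
  proof -
    have "(\<Sum>x\<in>V. card (N x)) = (\<Sum>x\<in>R. card (N x)) + (\<Sum>x\<in>insert v (N v). card (N x))"
      unfolding R_def using fin NV V(2) by (intro sum.subset_diff) auto
    then show ?thesis using finN nbr_irrefl by simp
  qed
  ultimately show ?thesis using cardR m d n_ge by linarith
qed

section \<open>Maximal degree n - 3\<close>

text \<open>If b and c both lie outside N u, a path u a b c uses up only one neighbour of u and n -
  4 remain. So a vertex at distance two from u has all its neighbours in N u, and by connectedness
  there are no vertices further away.\<close>

lemma independent_complement:
  assumes V: "nbr_connected V" "u \<in> V" and d: "card (N u) = n - 3" and x: "x \<in> V - N u"
  shows "N x \<subseteq> N u"
proof -
  have finN: "finite (N u)"
    using V finite_nbr by (auto simp: nbr_connected_def nbr_closed_def)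
  have path: "b \<in> N u \<or> c \<in> N u"
    if "a \<in> N u" "b \<in> N a" "c \<in> N b" "b \<noteq> u" "c \<noteq> u" "c \<noteq> a" for a b c
  proof (rule ccontr)
    assume "\<not> ?thesis"
    then have "N u - {a, b, c} = N u - {a}" by blast
    then have "card (N u - {a, b, c}) = n - 4" using that(1) d finN n_ge by simp
    then show False using no_spider[OF that] by simp
  qed
  have far: "N x \<subseteq> N u" if "a \<in> N u" "x \<in> N a" "x \<notin> insert u (N u)" for a x
  proof
    fix c assume "c \<in> N x"
    have "u \<notin> N x" using that nbr_sym by blast
    then show "c \<in> N u"
      using path[of a x c] that \<open>c \<in> N x\<close> by blast
  qed
  have "x = u \<or> x \<in> N u \<or> (\<exists>a\<in>N u. x \<in> N a)"
    using far x by (intro connected_reach[OF V]) blast+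
  then show ?thesis using far x by blast
qed

text \<open>Every edge has an end in N v, because the complement is independent, and N v consists of
  n - 3 vertices of degree at most n - 3.\<close>

lemma sum_le_twice_square:
  assumes V: "nbr_connected V" "v \<in> V" and d: "card (N v) = n - 3"
    and max: "\<And>x. x \<in> V \<Longrightarrow> card (N x) \<le> n - 3"
  shows "(\<Sum>x\<in>V. card (N x)) \<le> 2 * (n - 3) * (n - 3)"
proof -
  have cl: "nbr_closed V" and fin: "finite V" and NV: "N v \<subseteq> V" and finN: "finite (N v)"
    using V finite_nbr by (auto simp: nbr_connected_def nbr_closed_def)
  have ind: "N x \<subseteq> N v" if "x \<in> V - N v" for x
    using independent_complement[OF V d that] .
  have N: "(\<Sum>x\<in>N v. card (N x)) \<le> (n - 3) * (n - 3)"
    using sum_card_le[of "N v" "n - 3"] max NV d by auto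
  have "(\<Sum>x\<in>V - N v. card (N x)) = (\<Sum>x\<in>V - N v. card (N x \<inter> N v))"
    using ind by (intro sum.cong refl arg_cong[of _ _ card]) blast
  also have "\<dots> = (\<Sum>y\<in>N v. card (N y \<inter> (V - N v)))"
    using fin finN by (intro sum_card_swap) auto
  also have "\<dots> \<le> (\<Sum>y\<in>N v. card (N y))"
    using finite_nbr[OF cl] NV by (intro sum_mono card_mono) auto
  finally have "(\<Sum>x\<in>V - N v. card (N x)) \<le> (n - 3) * (n - 3)" using N by linarith
  then show ?thesis using sum.subset_diff[OF NV fin, of "\<lambda>x. card (N x)"] N by linarith
qed

lemma sum_le_split:
  assumes "finite V" "A \<subseteq> V" "card V = m" "card A = t"
    and "\<And>x. x \<in> A \<Longrightarrow> card (N x) \<le> i" and "\<And>x. x \<in> V - A \<Longrightarrow> card (N x) \<le> j"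
  shows "(\<Sum>x\<in>V. card (N x)) \<le> t * i + (m - t) * j"
proof -
  have "card (V - A) = m - t" using assms(1-4) by (metis card_Diff_subset finite_subset)
  then have "(\<Sum>x\<in>V - A. card (N x)) \<le> (m - t) * j"
    using sum_card_le[of "V - A" j] assms(6) by simp
  moreover have "(\<Sum>x\<in>A. card (N x)) \<le> t * i"
    using sum_card_le[of A i] assms(4,5) by simp
  ultimately show ?thesis
    using sum.subset_diff[OF assms(2,1), of "\<lambda>x. card (N x)"] by linarith
qed

text \<open>Inclusion and exclusion: s is the common size of the two complements and t their
  overlap, which together determine the number of common neighbours.\<close>

lemma pair_facts:
  assumes V: "nbr_connected V" and u: "u1 \<in> V" "u2 \<in> V"
    and d: "card (N u1) = n - 3" "card (N u2) = n - 3"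
    and t: "t = card (V - N u1 - N u2)" and s: "card V = n - 3 + s"
  shows "card (V - N u1) = s" "card (V - N u2) = s" "t \<le> s"
    and "card (N u1 \<inter> N u2) + 2 * s = card V + t"
proof -
  have fin: "finite V" and N: "N u1 \<subseteq> V" "N u2 \<subseteq> V" and finN: "finite (N u1)" "finite (N u2)"
    using V u finite_nbr by (auto simp: nbr_connected_def nbr_closed_def)
  show 1: "card (V - N u1) = s" "card (V - N u2) = s"
    using N finN d s by (simp_all add: card_Diff_subset)
  show "t \<le> s" using 1(1) fin unfolding t by (metis Diff_subset card_mono finite_Diff)
  have "card (N u1) + card (N u2) = card (N u1 \<union> N u2) + card (N u1 \<inter> N u2)"
    using finN by (rule card_Un_Int)
  moreover have "card (V - N u1 - N u2) = card V - card (N u1 \<union> N u2)"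
  proof -
    have "V - N u1 - N u2 = V - (N u1 \<union> N u2)" by blast
    then show ?thesis using N finN by (simp add: card_Diff_subset)
  qed
  moreover have "card (N u1 \<union> N u2) \<le> card V" using N fin by (intro card_mono) auto
  ultimately show "card (N u1 \<inter> N u2) + 2 * s = card V + t"
    using d s t by linarith
qed

text \<open>The second bound is strong when the overlap \<open>t\<close> of the independent sets \<open>V - N u1\<close> and
  \<open>V - N u2\<close> is at most 1, the first one when it is larger.\<close>

lemma sum_le_overlap:
  assumes V: "nbr_connected V" and u: "u1 \<in> V" "u2 \<in> V"
    and d: "card (N u1) = n - 3" "card (N u2) = n - 3"
    and max: "\<And>x. x \<in> V \<Longrightarrow> card (N x) \<le> n - 3"
    and t: "t = card (V - N u1 - N u2)" and s: "card V = n - 3 + s"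
    and q: "q = card (N u1 \<inter> N u2)"
  shows "(\<Sum>x\<in>V. card (N x)) \<le> t * q + (card V - t) * (n - 3)"
    and "(\<Sum>x\<in>V. card (N x)) \<le> 2 * (s - t) * (s - t) + 2 * q * (n - 3)"
proof -
  have cl: "nbr_closed V" and fin: "finite V" and N: "N u1 \<subseteq> V" "N u2 \<subseteq> V"
    and finN: "finite (N u1)" "finite (N u2)"
    using V u finite_nbr by (auto simp: nbr_connected_def nbr_closed_def)
  have ind1: "N x \<subseteq> N u1" if "x \<in> V - N u1" for x
    using independent_complement[OF V u(1) d(1) that] .
  have ind2: "N x \<subseteq> N u2" if "x \<in> V - N u2" for x
    using independent_complement[OF V u(2) d(2) that] .
  let ?Q = "N u1 \<inter> N u2"
  let ?T = "V - N u1 - N u2"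
  \<comment> \<open>A vertex lying in both independent sets sees only common neighbours of u1 and
    u2.\<close>
  have T: "card (N x) \<le> q" if "x \<in> ?T" for x
    unfolding q using that ind1[of x] ind2[of x] finN by (intro card_mono) auto
  show "(\<Sum>x\<in>V. card (N x)) \<le> t * q + (card V - t) * (n - 3)"
    by (rule sum_le_split[OF fin _ refl t[symmetric] T max]) blast+
  have c: "card (V - N u1) = s" "card (V - N u2) = s" "t \<le> s"
    using pair_facts[OF V u d t s] by auto
  \<comment> \<open>\<open>?A\<close> is N u2 without N u1, and \<open>?B\<close> is N u1 without N
    u2. By independence a vertex of \<open>?A\<close> has neighbours only in \<open>?B\<close> and
    \<open>?Q\<close>, and symmetrically; each of the two sets has s - t elements.\<close>
  let ?A = "V - N u1 - ?T" and ?B = "V - N u2 - ?T"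
  have "finite ?T" "?T \<subseteq> V - N u1" "?T \<subseteq> V - N u2" using fin by auto
  then have AB: "card ?A = s - t" "card ?B = s - t"
    by (simp_all only: card_Diff_subset c t)
  have part: "V - ?Q = ?T \<union> (?A \<union> ?B)" by blast
  have AQ: "card (N x) \<le> (s - t) + card (N x \<inter> ?Q)" if "x \<in> ?A" for x
  proof -
    have "N x \<subseteq> ?B \<union> (N x \<inter> ?Q)"
      using ind1[of x] that cl by (auto simp: nbr_closed_def)
    then have "card (N x) \<le> card (?B \<union> (N x \<inter> ?Q))"
      using fin finN by (intro card_mono) auto
    also have "\<dots> \<le> card ?B + card (N x \<inter> ?Q)" by (rule card_Un_le)
    finally show ?thesis using AB by simp
  qed
  have BQ: "card (N x) \<le> (s - t) + card (N x \<inter> ?Q)" if "x \<in> ?B" for x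
  proof -
    have "N x \<subseteq> ?A \<union> (N x \<inter> ?Q)"
      using ind2[of x] that cl by (auto simp: nbr_closed_def)
    then have "card (N x) \<le> card (?A \<union> (N x \<inter> ?Q))"
      using fin finN by (intro card_mono) auto
    also have "\<dots> \<le> card ?A + card (N x \<inter> ?Q)" by (rule card_Un_le)
    finally show ?thesis using AB by simp
  qed
  have TQ: "card (N x) = card (N x \<inter> ?Q)" if "x \<in> ?T" for x
    using ind1[of x] ind2[of x] that by (intro arg_cong[of _ _ card]) auto
  have disj: "?T \<inter> (?A \<union> ?B) = {}" "?A \<inter> ?B = {}" using N by auto
  have sub: "?Q \<subseteq> V" using N by blast
  have split: "(\<Sum>x\<in>V - ?Q. g x) = (\<Sum>x\<in>?T. g x) + ((\<Sum>x\<in>?A. g x) + (\<Sum>x\<in>?B. g x))"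
    for g :: "'a \<Rightarrow> nat"
    unfolding part using fin disj by (simp add: sum.union_disjoint)
  have "(\<Sum>x\<in>?A. card (N x)) \<le> (\<Sum>x\<in>?A. (s - t) + card (N x \<inter> ?Q))"
    using AQ by (intro sum_mono)
  moreover have "(\<Sum>x\<in>?B. card (N x)) \<le> (\<Sum>x\<in>?B. (s - t) + card (N x \<inter> ?Q))"
    using BQ by (intro sum_mono)
  moreover have "(\<Sum>x\<in>?T. card (N x)) = (\<Sum>x\<in>?T. card (N x \<inter> ?Q))"
    using TQ by (intro sum.cong) auto
  ultimately have "(\<Sum>x\<in>V - ?Q. card (N x)) \<le> 2 * (s - t) * (s - t) + (\<Sum>x\<in>V - ?Q. card (N x \<inter> ?Q))"
    unfolding split by (simp add: sum.distrib AB)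
  \<comment> \<open>The edges into \<open>?Q\<close> are charged to their ends in \<open>?Q\<close>,
    so together with the degrees in \<open>?Q\<close> itself they cost at most 2 * q * (n -
    3).\<close>
  also have "(\<Sum>x\<in>V - ?Q. card (N x \<inter> ?Q)) = (\<Sum>y\<in>?Q. card (N y \<inter> (V - ?Q)))"
    using fin finN by (intro sum_card_swap) auto
  also have "\<dots> \<le> (\<Sum>y\<in>?Q. card (N y))"
    using finite_nbr[OF cl] sub by (intro sum_mono card_mono) auto
  finally have "(\<Sum>x\<in>V - ?Q. card (N x)) \<le> 2 * (s - t) * (s - t) + (\<Sum>y\<in>?Q. card (N y))"
    by simp
  moreover have "(\<Sum>y\<in>?Q. card (N y)) \<le> q * (n - 3)"
    unfolding q using max sub by (intro sum_card_le) auto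
  ultimately show "(\<Sum>x\<in>V. card (N x)) \<le> 2 * (s - t) * (s - t) + 2 * q * (n - 3)"
    using sum.subset_diff[OF sub fin, of "\<lambda>x. card (N x)"] by linarith
qed

text \<open>If all neighbours of v have degree at most n - 4, they alone provide the deficiency.
  Otherwise two adjacent vertices of degree n - 3 feed \<open>sum_le_overlap\<close>, and one
  parameter triple is treated by hand.\<close>

lemma sum_le_small:
  assumes V: "nbr_connected V" "v \<in> V" and d: "card (N v) = n - 3"
    and max: "\<And>x. x \<in> V \<Longrightarrow> card (N x) \<le> n - 3"
    and m: "card V = n - 3 + s" and s: "3 \<le> s" "s < n - 3"
  shows "(\<Sum>x\<in>V. card (N x)) + loss n (s - 2) \<le> (n - 2) * card V"
proof (cases "\<exists>u \<in> N v. card (N u) = n - 3")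
  case False
  have fin: "finite V" and NV: "N v \<subseteq> V"
    using V by (auto simp: nbr_connected_def nbr_closed_def)
  have small: "card (N x) \<le> n - 4" if "x \<in> N v" for x
    using False max[of x] NV that by fastforce
  have "(\<Sum>x\<in>V. card (N x)) \<le> (n - 3) * (n - 4) + (card V - (n - 3)) * (n - 3)"
    using max by (intro sum_le_split[OF fin NV refl d small]) blast+
  moreover have "(n - 3) * (n - 4) + s * (n - 3) + loss n (s - 2) \<le> (n - 2) * (n - 3 + s)"
    using no_adjacent_pair_table n_ge n_le s unfolding set_upt by simp
  ultimately show ?thesis by (simp add: m)
next
  case True
  have cl: "nbr_closed V" and fin: "finite V" and NV: "N v \<subseteq> V"
    using V by (auto simp: nbr_connected_def nbr_closed_def)
  have pair: "(\<Sum>x\<in>V. card (N x)) + loss n (s - 2) \<le> (n - 2) * card V \<or>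
      n = 10 \<and> s = 5 \<and> card (V - N u1 - N u2) = 4"
    if u: "u1 \<in> V" "u2 \<in> N u1" "card (N u1) = n - 3" "card (N u2) = n - 3" for u1 u2
  proof -
    have u2: "u2 \<in> V" using u cl by (auto simp: nbr_closed_def)
    define t where "t = card (V - N u1 - N u2)"
    define q where "q = card (N u1 \<inter> N u2)"
    note facts = pair_facts[OF V(1) u(1) u2 u(3,4) t_def m]
    note bounds = sum_le_overlap[OF V(1) u(1) u2 u(3,4) max t_def m q_def]
    \<comment> \<open>The overlap is proper because u1 is a non-neighbour of itself but a neighbour
      of u2.\<close>
    have "u1 \<in> V - N u1" "u1 \<notin> V - N u1 - N u2" using u nbr_irrefl nbr_sym by blast+
    then have "V - N u1 - N u2 \<subset> V - N u1" by blast
    then have "card (V - N u1 - N u2) < card (V - N u1)"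
      using fin by (intro psubset_card_mono) auto
    then have ts: "t < s" unfolding t_def facts(1) .
    have q: "q = n - 3 - s + t" using facts(4) m s unfolding q_def by linarith
    show ?thesis
    proof -
      have "n \<in> {6..<11}" "s \<in> {3..<n - 3}" "t \<in> {0..<s}" using n_ge n_le s ts by simp_all
      with overlap_table[unfolded set_upt]
      have "t * (n - 3 - s + t) + (n - 3 + s - t) * (n - 3) + loss n (s - 2) \<le> (n - 2) * (n - 3 + s) \<or>
          2 * (s - t) * (s - t) + 2 * (n - 3 - s + t) * (n - 3) + loss n (s - 2) \<le> (n - 2) * (n - 3 + s) \<or>
          n = 10 \<and> s = 5 \<and> t = 4"
        by blast
      then show ?thesis using bounds unfolding q m t_def[symmetric] by linarith
    qed
  qed
  obtain u where u: "u \<in> N v" "card (N u) = n - 3" using True by blast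
  have uV: "u \<in> V" using u NV by blast
  show ?thesis
  proof (rule ccontr)
    assume contra: "\<not> ?thesis"
    have n: "n = 10" "s = 5" and t: "card (V - N v - N u) = 4"
      using pair[OF V(2) u(1) d u(2)] contra by blast+
    have m': "card V = 12" using m n by simp
    have large: "78 < (\<Sum>x\<in>V. card (N x))" using contra n m' by (simp add: loss_def)
    have d7: "card (N v) = 7" "card (N u) = 7" using d u n by simp_all
    note facts = pair_facts[OF V(1) V(2) uV d u(2) t[symmetric] m]
    let ?Q = "N v \<inter> N u"
    have Q: "card ?Q = 6" using facts(4) m' n by simp
    \<comment> \<open>Two independent sets only bound the degree sum by 80 instead of 78, so a third one is used.\<close>
    show False
    proof (cases "\<exists>w \<in> ?Q. card (N w) = 7")
      case False
      have "card (N x) \<le> 6" if "x \<in> ?Q" for x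
      proof -
        have "card (N x) \<noteq> 7" "x \<in> V" using False NV that by blast+
        then show ?thesis using max[of x] n by linarith
      qed
      then have "(\<Sum>x\<in>V. card (N x)) \<le> 6 * 6 + (card V - 6) * 7"
        using max NV n by (intro sum_le_split[OF fin _ refl Q]) auto
      then show False using large m' by simp
    next
      case True
      then obtain w where w: "w \<in> N v" "w \<in> N u" "card (N w) = 7" by blast
      have wV: "w \<in> V" using w NV by blast
      have dw: "card (N w) = n - 3" using w n by simp
      have t': "card (V - N v - N w) = 4"
        using pair[OF V(2) w(1) d dw] contra by blast
      have C: "card (V - N v) = 5" using facts(1) n by simp
      \<comment> \<open>Of the five non-neighbours of v, the neighbour x of v misses exactly four,
        and it is adjacent to v. So the overlap is the same set for x = u and x = w, and its
        vertices see only common neighbours of v, u and w.\<close>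
      have T: "V - N v - N x = V - N v - {v}" if "x \<in> N v" "card (V - N v - N x) = 4" for x
      proof (rule card_subset_eq)
        show "V - N v - N x \<subseteq> V - N v - {v}" using that nbr_sym by blast
        show "card (V - N v - N x) = card (V - N v - {v})"
          using that C fin V(2) nbr_irrefl by simp
      qed (use fin in auto)
      let ?T = "V - N v - {v}"
      have cT: "card ?T = 4" using T[OF u(1) t] t by simp
      have "card (N x) \<le> 5" if x: "x \<in> ?T" for x
      proof -
        have "x \<in> V - N v - N u" "x \<in> V - N v - N w" using T[OF u(1) t] T[OF w(1) t'] x by simp_all
        then have "N x \<subseteq> N v" "N x \<subseteq> N u" "N x \<subseteq> N w"
          using independent_complement[OF V(1)] V(2) uV wV d u(2) dw by blast+
        then have "N x \<subseteq> N v - {u, w}" using nbr_irrefl by blast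
        moreover have "u \<noteq> w" using w nbr_irrefl by blast
        then have "card (N v - {u, w}) = 5" using u w d7 by (simp add: card_Diff_subset)
        moreover have "finite (N v)" using finite_nbr[OF cl V(2)] .
        ultimately show ?thesis by (metis card_mono finite_Diff)
      qed
      then have "(\<Sum>x\<in>V. card (N x)) \<le> 4 * 5 + (card V - 4) * 7"
        using max n by (intro sum_le_split[OF fin _ refl cT]) auto
      then show False using large m' by simp
    qed
  qed
qed

section \<open>Assembling the degree bound\<close>

lemma sum_degrees_connected:
  assumes V: "nbr_connected V" "V \<noteq> {}"
  shows "(\<Sum>x\<in>V. card (N x)) + gap n (card V) \<le> (n - 2) * card V"
proof -
  have cl: "nbr_closed V" and fin: "finite V" using V by (auto simp: nbr_connected_def nbr_closed_def)
  have pos: "0 < card V" using V(2) fin by (simp add: card_gt_0_iff)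
  define m where "m = card V"
  define S where "S = (\<Sum>x\<in>V. card (N x))"
  have n: "n = 6 \<or> n = 7 \<or> n = 8 \<or> n = 9 \<or> n = 10" using n_ge n_le by linarith
  have sum_le: "S \<le> m * k" if "\<And>x. x \<in> V \<Longrightarrow> card (N x) \<le> k" for k
    unfolding S_def m_def using that by (rule sum_card_le)
  consider (few) "m < n"
    | (large) v where "n \<le> m" "v \<in> V" "n - 1 \<le> card (N v)"
    | (n2) v where "n \<le> m" "v \<in> V" "card (N v) = n - 2"
    | (n3) v where "n \<le> m" "v \<in> V" "card (N v) = n - 3" "\<And>x. x \<in> V \<Longrightarrow> card (N x) \<le> n - 3"
    | (small) "n \<le> m" "\<And>x. x \<in> V \<Longrightarrow> card (N x) \<le> n - 4"
  proof -
    have *: "\<exists>v\<in>V. n - 1 \<le> card (N v) \<or> card (N v) = n - 2"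
      if "x \<in> V" "\<not> card (N x) \<le> n - 3" for x
      using that by (intro bexI[of _ x]) linarith
    have **: "\<exists>v\<in>V. card (N v) = n - 3" if "x \<in> V" "\<not> card (N x) \<le> n - 4" "card (N x) \<le> n - 3" for x
      using that by (intro bexI[of _ x]) linarith
    show thesis
    proof (cases "\<forall>x\<in>V. card (N x) \<le> n - 3")
      case True
      then show thesis using ** few n3 small by (meson not_le_imp_less)
    next
      case False
      then show thesis using * few large n2 by (meson not_le_imp_less)
    qed
  qed
  then have "S + gap n m \<le> (n - 2) * m"
  proof cases
    case few
    have "card (N x) \<le> m - 1" if "x \<in> V" for x
    proof -
      have "N x \<subseteq> V - {x}" using that cl nbr_irrefl by (auto simp: nbr_closed_def)
      then have "card (N x) \<le> card (V - {x})" using fin by (intro card_mono) auto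
      then show ?thesis using that fin by (simp add: m_def)
    qed
    then have "S \<le> m * (m - 1)" by (rule sum_le)
    moreover have "m * (m - 1) + m * (n - 1 - m) = (n - 2) * m"
    proof -
      have "(m - 1) + (n - 1 - m) = n - 2" using few pos by (simp add: m_def)
      then show ?thesis by (metis add_mult_distrib2 mult.commute)
    qed
    ultimately show ?thesis using few by (simp add: gap_def)
  next
    \<comment> \<open>\<open>gap_le\<close> bounds the deficit by 3 * (n - 4); for n = 6 this is
      exactly the 6 gained here.\<close>
    case (large v)
    have "S + 6 \<le> 4 * m"
      unfolding S_def m_def by (rule sum_le_of_large_degree[OF V(1) large(2,3)])
    then show ?thesis using n gap_le[OF n_ge n_le large(1)] large(1) by auto
  next
    case (n2 v)
    have "S + 2 \<le> 2 * m + (n - 3) * (n - 4)"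
      using sum_le_of_degree_n_minus_2[OF V(1) n2(2,3)] n2(1) unfolding S_def m_def by simp
    then show ?thesis using n gap_le[OF n_ge n_le n2(1)] n2(1) by auto
  next
    \<comment> \<open>The slack is 2 * m, at least 2 * n, which covers 3 * (n - 4) because n is at
      most 10.\<close>
    case small
    then have "S \<le> m * (n - 4)" by (intro sum_le)
    then show ?thesis using n gap_le[OF n_ge n_le small(1)] small(1) by auto
  next
    case (n3 v)
    show ?thesis
    proof (cases "m < 2 * n - 6")
      case True
      define s where "s = m - (n - 3)"
      have s: "3 \<le> s" "s < n - 3" "card V = n - 3 + s"
        using True n3(1) n_ge by (auto simp: s_def m_def)
      have "m = (s - 2) + (n - 1)" "s - 2 < n - 1" using s n_ge by (auto simp: m_def)
      then have "m mod (n - 1) = s - 2" by (metis mod_add_self2 mod_less)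
      then have "gap n m = loss n (s - 2)" using n3(1) by (simp add: gap_def)
      then show ?thesis
        using sum_le_small[OF V(1) n3(2,3,4) s(3,1,2)] by (simp add: S_def m_def)
    next
      case False
      have S: "S \<le> 2 * (n - 3) * (n - 3)"
        using sum_le_twice_square[OF V(1) n3(2,3,4)] by (simp add: S_def)
      show ?thesis
      \<comment> \<open>At m = 2 * n - 6 the residue is n - 5 and the slack 2 * (n - 3), which is
        the exceptional \<open>loss\<close> for n from 8 to 10. From the next m on the slack exceeds
        3 * (n - 4).\<close>
      proof (cases "m = 2 * n - 6")
        case True
        then show ?thesis using n S by (auto simp: gap_def loss_def)
      next
        case ne: False
        show ?thesis using n S False ne gap_le[OF n_ge n_le n3(1)] by auto
      qed
    qed
  qed
  then show ?thesis by (simp add: S_def m_def)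
qed

text \<open>A proper nonempty closed subset splits off with a complement that is closed by symmetry;
  the two deficits combine by \<open>gap_add\<close>.\<close>

lemma sum_degrees_le:
  "nbr_closed V \<Longrightarrow> (\<Sum>x\<in>V. card (N x)) + gap n (card V) \<le> (n - 2) * card V"
proof (induction "card V" arbitrary: V rule: less_induct)
  case less
  have fin: "finite V" using less.prems by (simp add: nbr_closed_def)
  show ?case
  proof (cases "V = {} \<or> nbr_connected V")
    case True
    then show ?thesis
    proof (cases "V = {}")
      case True
      then show ?thesis using n_ge by (simp add: gap_def)
    qed (use sum_degrees_connected in blast)
  next
    case False
    then obtain C where C: "C \<subseteq> V" "C \<noteq> {}" "nbr_closed C" "C \<noteq> V"
      using less.prems by (auto simp: nbr_connected_def)
    have D: "nbr_closed (V - C)"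
    proof -
      have "N x \<subseteq> V - C" if "x \<in> V - C" for x
      proof
        fix y assume y: "y \<in> N x"
        have "y \<notin> C"
          using C(3) nbr_sym[OF y] that by (auto simp: nbr_closed_def)
        then show "y \<in> V - C" using less.prems y that by (auto simp: nbr_closed_def)
      qed
      then show ?thesis using fin by (simp add: nbr_closed_def)
    qed
    have finC: "finite C" using C fin finite_subset by blast
    have card: "card V = card C + card (V - C)"
      using C(1) fin finC by (simp add: card_Diff_subset card_mono)
    have "0 < card C" "0 < card (V - C)"
      using C fin finC by (auto simp: card_gt_0_iff)
    then have "card C < card V" "card (V - C) < card V" unfolding card by simp_all
    then have "(\<Sum>x\<in>C. card (N x)) + gap n (card C) \<le> (n - 2) * card C"
        "(\<Sum>x\<in>V - C. card (N x)) + gap n (card (V - C)) \<le> (n - 2) * card (V - C)"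
      using less.hyps C(3) D by blast+
    moreover have "gap n (card V) \<le> gap n (card C) + gap n (card (V - C))"
      unfolding card using n_ge n_le by (rule gap_add)
    moreover have "(n - 2) * card V = (n - 2) * card C + (n - 2) * card (V - C)"
      unfolding card by (rule add_mult_distrib2)
    ultimately show ?thesis
      using sum.subset_diff[OF C(1) fin, of "\<lambda>x. card (N x)"] by linarith
  qed
qed

end

section \<open>From tree copies to neighbourhoods and back\<close>

definition nbrs :: "'a set set \<Rightarrow> 'a \<Rightarrow> 'a set" where
  "nbrs E v = {u. {v, u} \<in> E}"

text \<open>The tree is a spider: centre v, one leg v a b c of length three and n - 4 legs of length
  one. Only the number of available short legs matters, so they are not named.\<close>

definition has_spider :: "nat \<Rightarrow> 'a set set \<Rightarrow> bool" where
  "has_spider n E \<longleftrightarrow> (\<exists>v a b c. a \<in> nbrs E v \<and> b \<in> nbrs E a \<and> c \<in> nbrs E b \<and>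
     b \<noteq> v \<and> c \<noteq> v \<and> c \<noteq> a \<and> n - 4 \<le> card (nbrs E v - {a, b, c}))"

lemma nbrs_sym: "u \<in> nbrs E v \<longleftrightarrow> v \<in> nbrs E u"
  by (simp add: nbrs_def insert_commute)

lemma doubleton_in_nsets: "{v, u} \<in> nsets V 2 \<longleftrightarrow> v \<in> V \<and> u \<in> V \<and> v \<noteq> u"
  by (auto simp: nsets_def card_insert_if)

lemma nbrs_subset:
  assumes "E \<subseteq> nsets V 2"
  shows "nbrs E v \<subseteq> V - {v}"
proof
  fix u assume "u \<in> nbrs E v"
  then have "{v, u} \<in> nsets V 2" using assms unfolding nbrs_def by blast
  then show "u \<in> V - {v}" unfolding doubleton_in_nsets by blast
qed

lemma nbrs_nonempty: "E \<subseteq> nsets V 2 \<Longrightarrow> u \<in> nbrs E v \<Longrightarrow> v \<in> V"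
  using nbrs_subset[of E V u] nbrs_sym[of u E v] by blast

lemma T_star_edges:
  assumes "n \<ge> 6"
  shows "(\<forall>e \<in> edges (T_star n). P e) \<longleftrightarrow>
    (\<forall>i \<in> {1..n - 3}. P {0, i}) \<and> P {n - 3, n - 2} \<and> P {n - 2, n - 1}"
proof -
  have "edges (T_star n) = (\<lambda>i. {0, i}) ` {1..n - 3} \<union> {{n - 3, n - 2}, {n - 2, n - 1}}"
    by (auto simp: T_star_def edges_def)
  then show ?thesis by auto
qed

lemma T_star_verts: "verts (T_star n) = {0..<n}"
  by (simp add: T_star_def verts_def)

lemma has_spider_if_contains:
  assumes G: "simple_graph G" and n: "n \<ge> 6" and c: "contains_subgraph G (T_star n)"
  shows "has_spider n (edges G)"
proof -
  have E: "edges G \<subseteq> nsets (verts G) 2" and fin: "finite (verts G)"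
    using G by (auto simp: simple_graph_def)
  obtain f where inj: "inj_on f {0..<n}" and f: "\<And>i. i \<in> {1..n - 3} \<Longrightarrow> {f 0, f i} \<in> edges G"
    "{f (n - 3), f (n - 2)} \<in> edges G" "{f (n - 2), f (n - 1)} \<in> edges G"
    using c unfolding contains_subgraph_def T_star_edges[OF n] T_star_verts by auto
  let ?S = "nbrs (edges G) (f 0) - {f (n - 3), f (n - 2), f (n - 1)}"
  have eq: "f i = f j \<longleftrightarrow> i = j" if "i < n" "j < n" for i j
    using inj_on_eq_iff[OF inj] that by simp
  have "f ` {1..n - 4} \<subseteq> ?S"
    using f(1) eq n by (auto simp: nbrs_def)
  moreover have "finite ?S" using nbrs_subset[OF E] fin by (meson finite_Diff finite_subset)
  ultimately have "card (f ` {1..n - 4}) \<le> card ?S" by (rule card_mono[rotated])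
  moreover have "card (f ` {1..n - 4}) = n - 4"
  proof -
    have "{1..n - 4} \<subseteq> {0..<n}" using n by auto
    then show ?thesis using card_image[OF inj_on_subset[OF inj]] by simp
  qed
  ultimately have "n - 4 \<le> card ?S" by simp
  moreover have "f (n - 3) \<in> nbrs (edges G) (f 0)" "f (n - 2) \<in> nbrs (edges G) (f (n - 3))"
    "f (n - 1) \<in> nbrs (edges G) (f (n - 2))"
    using f n by (simp_all add: nbrs_def)
  moreover have "f (n - 2) \<noteq> f 0" "f (n - 1) \<noteq> f 0" "f (n - 1) \<noteq> f (n - 3)"
    using eq n by simp_all
  ultimately show ?thesis unfolding has_spider_def by blast
qed

lemma contains_if_has_spider:
  assumes G: "simple_graph G" and n: "n \<ge> 6" and sp: "has_spider n (edges G)"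
  shows "contains_subgraph G (T_star n)"
proof -
  have E: "edges G \<subseteq> nsets (verts G) 2"
    using G by (auto simp: simple_graph_def)
  obtain v a b c where sp: "a \<in> nbrs (edges G) v" "b \<in> nbrs (edges G) a" "c \<in> nbrs (edges G) b"
    "b \<noteq> v" "c \<noteq> v" "c \<noteq> a" "n - 4 \<le> card (nbrs (edges G) v - {a, b, c})"
    using sp unfolding has_spider_def by blast
  obtain S where S: "S \<subseteq> nbrs (edges G) v - {a, b, c}" "card S = n - 4" "finite S"
    using obtain_subset_with_card_n[OF sp(7)] by blast
  obtain g where g: "bij_betw g {1..n - 4} S"
    using finite_same_card_bij[of "{1..n - 4}" S] S by auto
  have gS: "g i \<in> S" if "1 \<le> i" "i \<le> n - 4" for i
    using g that by (auto simp: bij_betw_def)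
  have ne: "v \<noteq> a" "a \<noteq> b" "b \<noteq> c" "v \<notin> S" "a \<notin> S" "b \<notin> S" "c \<notin> S"
    using sp S nbrs_subset[OF E] by blast+
  have mem: "v \<in> verts G" "a \<in> verts G" "b \<in> verts G" "c \<in> verts G" "S \<subseteq> verts G"
    using sp S nbrs_subset[OF E] nbrs_nonempty[OF E] by blast+
  \<comment> \<open>The centre is vertex 0, the n - 4 short legs are 1 to n - 4, and the long leg
    takes the last three indices.\<close>
  define f where "f i = (if i = 0 then v else if i \<le> n - 4 then g i
     else if i = n - 3 then a else if i = n - 2 then b else c)" for i
  have f: "f 0 = v" "f (n - 3) = a" "f (n - 2) = b" "f (n - 1) = c"
    and fg: "\<And>i. 1 \<le> i \<Longrightarrow> i \<le> n - 4 \<Longrightarrow> f i = g i"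
    using n by (auto simp: f_def)
  \<comment> \<open>In this order injectivity on the leaves extends by one index at a time.\<close>
  have idx: "{0..<n} = insert 0 (insert (n - 3) (insert (n - 2) (insert (n - 1) {1..n - 4})))"
    using n by auto
  have img: "f ` {1..n - 4} = S" and inj: "inj_on f {1..n - 4}"
    using g fg by (auto simp: bij_betw_def inj_on_def)
  have step: "inj_on f (insert x A)" if "inj_on f A" "f x \<notin> f ` A" for x A
    using that by auto
  have "inj_on f {0..<n}"
    unfolding idx by (intro step inj; simp only: image_insert img f) (use ne sp(4-6) in auto)
  moreover have "f ` {0..<n} \<subseteq> verts G"
    unfolding idx image_insert img f using mem by blast
  moreover have "{f 0, f i} \<in> edges G" if "i \<in> {1..n - 3}" for i
  proof -
    have "i = n - 3 \<or> (1 \<le> i \<and> i \<le> n - 4)" using that by auto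
    then show ?thesis using gS[of i] S(1) sp(1) by (auto simp: f fg nbrs_def)
  qed
  moreover have "{f (n - 3), f (n - 2)} \<in> edges G" "{f (n - 2), f (n - 1)} \<in> edges G"
    using sp(2,3) unfolding f nbrs_def by simp_all
  ultimately show ?thesis
    unfolding contains_subgraph_def T_star_edges[OF n] T_star_verts by auto
qed

lemma handshake:
  assumes "finite V" "E \<subseteq> nsets V 2"
  shows "(\<Sum>v\<in>V. card (nbrs E v)) = 2 * card E"
proof -
  have "bij_betw (\<lambda>u. {v, u}) (nbrs E v) {e \<in> E. v \<in> e}" for v
  proof (intro bij_betwI' )
    fix e assume e: "e \<in> {e \<in> E. v \<in> e}"
    then have "card e = 2" using assms(2) by (auto simp: nsets_def)
    then obtain x y where "e = {x, y}" by (auto simp: card_2_iff)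
    then show "\<exists>u\<in>nbrs E v. e = {v, u}" using e by (auto simp: nbrs_def insert_commute)
  qed (auto simp: nbrs_def doubleton_eq_iff)
  then have "(\<Sum>v\<in>V. card (nbrs E v)) = (\<Sum>v\<in>V. card {e \<in> E. v \<in> e})"
    by (intro sum.cong refl bij_betw_same_card)
  also have "\<dots> = 2 * card E"
  proof (rule sum_multicount)
    show "\<forall>e\<in>E. card {v \<in> V. v \<in> e} = 2"
    proof
      fix e assume "e \<in> E"
      then have "e \<subseteq> V" "card e = 2" using assms(2) by (auto simp: nsets_def)
      moreover from this have "{v \<in> V. v \<in> e} = e" by blast
      ultimately show "card {v \<in> V. v \<in> e} = 2" by simp
    qed
  qed (use assms finite_imp_finite_nsets finite_subset in blast)+
  finally show ?thesis .
qed

lemma card_edges_le: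
  assumes "6 \<le> n" "n \<le> 10" and G: "simple_graph G" and free: "\<not> contains_subgraph G (T_star n)"
  shows "2 * card (edges G) + gap n (card (verts G)) \<le> (n - 2) * card (verts G)"
proof -
  have E: "edges G \<subseteq> nsets (verts G) 2" and fin: "finite (verts G)"
    using G by (auto simp: simple_graph_def)
  have "\<not> has_spider n (edges G)"
    using contains_if_has_spider[OF G assms(1)] free by blast
  then have free: "\<not> n - 4 \<le> card (nbrs (edges G) v - {a, b, c})"
    if "a \<in> nbrs (edges G) v" "b \<in> nbrs (edges G) a" "c \<in> nbrs (edges G) b"
      "b \<noteq> v" "c \<noteq> v" "c \<noteq> a" for v a b c
    using that unfolding has_spider_def by blast
  interpret spider_free "nbrs (edges G)" n
  proof
    show "v \<in> nbrs (edges G) u" if "u \<in> nbrs (edges G) v" for u v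
      using that nbrs_sym by metis
    show "v \<notin> nbrs (edges G) v" for v using nbrs_subset[OF E] by blast
  qed (use assms(1,2) free in \<open>simp_all add: not_le\<close>)
  have "nbr_closed (verts G)"
    using nbrs_subset[OF E] fin by (auto simp: nbr_closed_def)
  from sum_degrees_le[OF this] show ?thesis by (simp add: handshake[OF fin E])
qed

section \<open>Extremal graphs\<close>

text \<open>Vertex sets are initial segments, so that a disjoint union is a shift.\<close>

definition realizable :: "nat \<Rightarrow> nat \<Rightarrow> nat \<Rightarrow> bool" where
  "realizable n p e \<longleftrightarrow> (\<exists>E. E \<subseteq> nsets {..<p} 2 \<and> card E = e \<and> \<not> has_spider n E)"

text \<open>The second graph is shifted by p. A spider is connected, so it lies in the part that
  contains its centre.\<close>

lemma realizable_add:
  assumes "realizable n p d" "realizable n q e"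
  shows "realizable n (p + q) (d + e)"
proof -
  obtain D where D: "D \<subseteq> nsets {..<p} 2" "card D = d" "\<not> has_spider n D"
    using assms(1) by (auto simp: realizable_def)
  obtain E where E: "E \<subseteq> nsets {..<q} 2" "card E = e" "\<not> has_spider n E"
    using assms(2) by (auto simp: realizable_def)
  let ?s = "(+) p"
  let ?F = "D \<union> (`) ?s ` E"
  have inj: "inj ?s" by simp
  have Dn: "x \<subseteq> {..<p}" "x \<noteq> {}" if "x \<in> D" for x
    using D(1) that by (auto simp: nsets_def)
  have En: "x \<subseteq> {..<q}" "x \<noteq> {}" "card x = 2" if "x \<in> E" for x
    using E(1) that by (auto simp: nsets_def)
  have "?s ` x \<in> nsets {..<p + q} 2" if "x \<in> E" for x
    using En[OF that] by (auto simp: nsets_def card_image finite_subset)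
  moreover have "D \<subseteq> nsets {..<p + q} 2"
    using D(1) nsets_mono[of "{..<p}" "{..<p + q}" 2] by auto
  ultimately have F: "?F \<subseteq> nsets {..<p + q} 2" by blast
  have "D \<inter> (`) ?s ` E = {}"
  proof (intro equals0I)
    fix y assume "y \<in> D \<inter> (`) ?s ` E"
    then obtain x where "x \<in> E" "?s ` x \<in> D" by blast
    then show False using Dn[of "?s ` x"] En[of x] by auto
  qed
  moreover have "finite D" "finite E"
    using D(1) E(1) by (auto intro: finite_subset finite_imp_finite_nsets)
  moreover have "card ((`) ?s ` E) = card E"
    by (intro card_image inj_on_image) (simp add: inj_on_def)
  ultimately have cardF: "card ?F = d + e" using D(2) E(2) by (simp add: card_Un_disjoint)
  have low: "nbrs ?F v = nbrs D v" if "v < p" for v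
  proof -
    have "{v, u} \<notin> (`) ?s ` E" for u
    proof
      assume "{v, u} \<in> (`) ?s ` E"
      then obtain x where "{v, u} = ?s ` x" by blast
      then have "v \<in> ?s ` x" by blast
      then show False using that by auto
    qed
    then show ?thesis by (simp add: nbrs_def)
  qed
  have high: "nbrs ?F (p + w) = ?s ` nbrs E w" for w
  proof -
    have "{p + w, u} \<notin> D" for u using Dn[of "{p + w, u}"] by auto
    moreover have "{p + w, u} \<in> (`) ?s ` E \<longleftrightarrow> u \<in> ?s ` nbrs E w" for u
    proof
      assume "{p + w, u} \<in> (`) ?s ` E"
      then obtain x where x: "x \<in> E" "{p + w, u} = ?s ` x" by blast
      then have "u \<in> ?s ` x" by blast
      then obtain y where y: "u = p + y" by blast
      then have "?s ` {w, y} = ?s ` x" using x(2) by simp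
      then have "{w, y} = x" using inj by (metis inj_image_eq_iff)
      then show "u \<in> ?s ` nbrs E w" using x(1) y by (auto simp: nbrs_def)
    next
      assume "u \<in> ?s ` nbrs E w"
      then obtain y where "u = p + y" "{w, y} \<in> E" by (auto simp: nbrs_def)
      then show "{p + w, u} \<in> (`) ?s ` E" by (intro image_eqI[of _ _ "{w, y}"]) auto
    qed
    ultimately show ?thesis by (auto simp: nbrs_def)
  qed
  have "\<not> has_spider n ?F"
  proof
    assume "has_spider n ?F"
    then obtain v a b c where sp: "a \<in> nbrs ?F v" "b \<in> nbrs ?F a" "c \<in> nbrs ?F b"
      "b \<noteq> v" "c \<noteq> v" "c \<noteq> a" "n - 4 \<le> card (nbrs ?F v - {a, b, c})"
      unfolding has_spider_def by blast
    show False
    proof (cases "v < p")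
      case True
      note v = low[OF True]
      have "a < p" using sp(1) nbrs_subset[OF D(1)] v by blast
      note a = low[OF this]
      have "b < p" using sp(2) nbrs_subset[OF D(1)] a by blast
      note b = low[OF this]
      show False using D(3) sp unfolding v a b has_spider_def by blast
    next
      case False
      then obtain v' where v: "v = p + v'" by (metis le_Suc_ex not_less)
      then obtain a' where a: "a = p + a'" "a' \<in> nbrs E v'" using sp(1) high by auto
      then obtain b' where b: "b = p + b'" "b' \<in> nbrs E a'" using sp(2) high by auto
      then obtain c' where c: "c = p + c'" "c' \<in> nbrs E b'" using sp(3) high by auto
      have "nbrs ?F v - {a, b, c} = ?s ` (nbrs E v' - {a', b', c'})"
        unfolding v high a(1) b(1) c(1) by auto
      then have "card (nbrs ?F v - {a, b, c}) = card (nbrs E v' - {a', b', c'})"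
        by (simp add: card_image)
      then have "n - 4 \<le> card (nbrs E v' - {a', b', c'})" using sp(7) by simp
      moreover have "b' \<noteq> v'" "c' \<noteq> v'" "c' \<noteq> a'" using sp(4-6) v a b c by auto
      ultimately show False using E(3) a(2) b(2) c(2) unfolding has_spider_def by blast
    qed
  qed
  then show ?thesis using F cardF unfolding realizable_def by blast
qed

text \<open>A spider occupies 4 + (n - 4) vertices, more than there are.\<close>

lemma realizable_complete:
  assumes "p < n" "4 \<le> n"
  shows "realizable n p (p choose 2)"
proof -
  let ?E = "nsets {..<p} 2"
  have "\<not> has_spider n ?E"
  proof
    assume "has_spider n ?E"
    then obtain v a b c where sp: "a \<in> nbrs ?E v" "b \<in> nbrs ?E a" "c \<in> nbrs ?E b"
      "b \<noteq> v" "c \<noteq> v" "c \<noteq> a" "n - 4 \<le> card (nbrs ?E v - {a, b, c})"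
      unfolding has_spider_def by blast
    have dist: "v \<noteq> a" "a \<noteq> b" "b \<noteq> c" and mem: "{v, a, b, c} \<subseteq> {..<p}"
      using sp(1-3) by (auto simp: nbrs_def doubleton_in_nsets)
    have "finite (nbrs ?E v)" using nbrs_subset[of ?E "{..<p}" v] finite_subset by blast
    moreover have "v \<notin> nbrs ?E v" by (simp add: nbrs_def doubleton_in_nsets)
    then have "{v, a, b, c} \<inter> (nbrs ?E v - {a, b, c}) = {}" by blast
    ultimately have "card ({v, a, b, c} \<union> (nbrs ?E v - {a, b, c}))
        = card {v, a, b, c} + card (nbrs ?E v - {a, b, c})"
      by (intro card_Un_disjoint) auto
    moreover have "card {v, a, b, c} = 4" using dist sp(4-6) by auto
    moreover have "{v, a, b, c} \<union> (nbrs ?E v - {a, b, c}) \<subseteq> {..<p}"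
      using mem nbrs_subset[of ?E "{..<p}" v] by blast
    then have "card ({v, a, b, c} \<union> (nbrs ?E v - {a, b, c})) \<le> p"
      using card_mono[of "{..<p}"] by fastforce
    ultimately show False using sp(7) assms by linarith
  qed
  then show ?thesis unfolding realizable_def by (metis card_lessThan card_nsets order_refl)
qed

lemma realizable_blocks:
  assumes "realizable n q e" "6 \<le> n"
  shows "realizable n (k * (n - 1) + q) (k * ((n - 1) choose 2) + e)"
proof (induction k)
  case (Suc k)
  have "realizable n (n - 1) ((n - 1) choose 2)" using assms(2) by (intro realizable_complete) auto
  from realizable_add[OF this Suc] show ?case by (simp add: add.assoc)
qed (use assms in simp)

text \<open>Converse to \<open>independent_complement\<close>: with degrees at most n - 3, a spider
  can spare no neighbour of its centre besides a, so b and c would be adjacent non-neighbours of a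
  vertex of degree n - 3.\<close>

lemma no_spider_if_independent:
  assumes E: "E \<subseteq> nsets V 2" and V: "finite V" and n: "5 \<le> n"
    and deg: "\<And>v. v \<in> V \<Longrightarrow> card (nbrs E v) \<le> n - 3"
    and ind: "\<And>v x. v \<in> V \<Longrightarrow> card (nbrs E v) = n - 3 \<Longrightarrow> x \<in> V - nbrs E v \<Longrightarrow> nbrs E x \<subseteq> nbrs E v"
  shows "\<not> has_spider n E"
proof
  assume "has_spider n E"
  then obtain v a b c where sp: "a \<in> nbrs E v" "b \<in> nbrs E a" "c \<in> nbrs E b"
    "n - 4 \<le> card (nbrs E v - {a, b, c})" "c \<noteq> a"
    unfolding has_spider_def by blast
  have "v \<in> V" "b \<in> V" using nbrs_nonempty[OF E] sp by blast+
  have fin: "finite (nbrs E v)" using nbrs_subset[OF E, of v] V finite_subset by blast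
  have "a \<noteq> b" using sp(2) nbrs_subset[OF E, of a] by blast
  have 1: "card (nbrs E v - {a}) = card (nbrs E v) - 1" using sp(1) fin by simp
  have "nbrs E v - {a, b, c} \<subseteq> nbrs E v - {a}" by blast
  then have "nbrs E v - {a, b, c} = nbrs E v - {a}"
    using 1 sp(4) deg[OF \<open>v \<in> V\<close>] fin n by (intro card_seteq) auto
  then have "b \<notin> nbrs E v" "c \<notin> nbrs E v" and "card (nbrs E v) = n - 3"
    using 1 sp(4,5) \<open>a \<noteq> b\<close> deg[OF \<open>v \<in> V\<close>] n by (blast, blast, simp)
  then show False using ind[of v b] \<open>v \<in> V\<close> \<open>b \<in> V\<close> sp(3) by blast
qed

definition bipartite :: "nat \<Rightarrow> nat \<Rightarrow> nat set set" where
  "bipartite k l = (\<lambda>(x, y). {x, y}) ` ({..<k} \<times> {k..<k + l})"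

lemma bipartite_edge: "{x, y} \<in> bipartite k l \<longleftrightarrow>
    x < k \<and> k \<le> y \<and> y < k + l \<or> y < k \<and> k \<le> x \<and> x < k + l"
  by (auto simp: bipartite_def doubleton_eq_iff)

lemma bipartite_nsets: "bipartite k l \<subseteq> nsets {..<k + l} 2"
  by (auto simp: bipartite_def doubleton_in_nsets)

lemma card_bipartite: "card (bipartite k l) = k * l"
proof -
  have "inj_on (\<lambda>(x, y). {x, y}) ({..<k} \<times> {k..<k + l})"
    by (auto simp: inj_on_def doubleton_eq_iff)
  then show ?thesis unfolding bipartite_def by (simp add: card_image)
qed

lemma nbrs_bipartite:
  "nbrs (bipartite k l) v = (if v < k then {k..<k + l} else if v < k + l then {..<k} else {})"
  by (auto simp: nbrs_def bipartite_edge)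

lemma realizable_bipartite:
  assumes "6 \<le> n"
  shows "realizable n (2 * n - 6) ((n - 3) * (n - 3))"
proof -
  let ?E = "bipartite (n - 3) (n - 3)"
  have "\<not> has_spider n ?E"
    using assms
    by (intro no_spider_if_independent[OF bipartite_nsets])
       (auto simp: nbrs_bipartite split: if_splits)
  moreover have "n - 3 + (n - 3) = 2 * n - 6" using assms by simp
  ultimately show ?thesis
    unfolding realizable_def using bipartite_nsets[of "n - 3" "n - 3"] card_bipartite by metis
qed

text \<open>The count is 7 * 6 + 1. The degree 7 = n - 3 occurs on the side of size 6 and at the
  ends 0 and 1 of the new edge; the non-neighbours of 0 are the rest of its side, which is
  independent without 1, and likewise for 1.\<close>

lemma realizable_bipartite_plus_edge: "realizable 10 13 43"
proof -
  define E where "E = insert {0, 1} (bipartite 7 6)"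
  have new: "{0, 1} \<notin> bipartite 7 6" unfolding bipartite_edge by simp
  have nb: "nbrs E v = (if v = 0 then insert 1 {7..<13} else if v = 1 then insert 0 {7..<13}
      else if v < 7 then {7..<13} else if v < 13 then {..<7} else {})" for v
    by (auto simp: E_def nbrs_def bipartite_edge doubleton_eq_iff)
  have "{0, 1} \<in> nsets {..<13::nat} 2" unfolding doubleton_in_nsets by simp
  then have E: "E \<subseteq> nsets {..<13} 2"
    using bipartite_nsets[of 7 6] by (simp add: E_def)
  have "\<not> has_spider 10 E"
    by (intro no_spider_if_independent[OF E]) (auto simp: nb split: if_splits)
  moreover have "card E = 43"
    using new finite_subset[OF bipartite_nsets finite_imp_finite_nsets]
    unfolding E_def by (simp add: card_bipartite)
  ultimately show ?thesis using E unfolding realizable_def by blast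
qed

lemma realizable_extremal:
  assumes n: "6 \<le> n" "n \<le> 10" and p: "n \<le> p"
  shows "\<exists>e. realizable n p e \<and> 2 * e + gap n p = (n - 2) * p"
proof -
  define k where "k = p div (n - 1)"
  define r where "r = p mod (n - 1)"
  have p_eq: "p = k * (n - 1) + r" unfolding k_def r_def by (rule div_mult_mod_eq[symmetric])
  have r: "r < n - 1" using n by (simp add: r_def)
  have gap: "gap n p = loss n r" using p by (simp add: gap_def r_def)
  have k: "0 < k" using p n by (simp add: k_def div_greater_zero_iff)
  \<comment> \<open>The exceptional graphs have n - 1 + r vertices: they replace the remainder
    together with one complete block, which exists as k is positive.\<close>
  have shift: "p = (k - 1) * (n - 1) + q" if "q = n - 1 + r" for q
    using p_eq k that by (cases k) auto
  have two: "2 * (m choose 2) = m * (m - 1)" for m :: nat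
  proof -
    have "even (m * (m - 1))" by (cases m) auto
    then show ?thesis by (simp add: choose_two)
  qed
  have choose: "2 * ((n - 1) choose 2) = (n - 1) * (n - 2)"
    using two[of "n - 1"] by (simp add: numeral_2_eq_2)
  \<comment> \<open>\<open>square\<close> covers r = n - 5 for n from 8 to 10, where n - 1 + r is
    the order of the balanced bipartite graph; in \<open>plus\<close> it is 13.\<close>
  consider (normal) "loss n r = r * (n - 1 - r)"
    | (square) "n - 1 + r = 2 * n - 6" "loss n r = 2 * (n - 3)"
    | (plus) "n = 10" "r = 4"
  proof -
    consider "n \<in> {8, 9} \<and> r = n - 5 \<or> n = 10 \<and> r = 5" | "n = 10 \<and> r = 4"
      | "\<not> (n \<in> {8, 9} \<and> r = n - 5)" "\<not> (n = 10 \<and> r = 5)" "\<not> (n = 10 \<and> r = 4)"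
      by blast
    then show thesis
    proof cases
      case 1
      then show thesis by (intro square) (auto simp: loss_def)
    next
      case 2
      then show thesis using plus by blast
    next
      case 3
      then show thesis by (intro normal) (simp only: loss_def if_False)
    qed
  qed
  then show ?thesis
  proof cases
    case normal
    have "realizable n p (k * ((n - 1) choose 2) + (r choose 2))"
      unfolding p_eq using n r by (intro realizable_blocks realizable_complete) auto
    moreover have "2 * (k * ((n - 1) choose 2) + (r choose 2)) + gap n p = (n - 2) * p"
    proof -
      have r_eq: "r * (r - 1) + r * (n - 1 - r) = r * (n - 2)"
      proof (cases "r = 0")
        case False
        then have "r - 1 + (n - 1 - r) = n - 2" using r by linarith
        then show ?thesis by (metis add_mult_distrib2)
      qed simp
      then show ?thesis
        unfolding gap normal distrib_left mult.left_commute[of 2 k] choose two[of r]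
        by (simp only: add.assoc r_eq p_eq) (simp only: distrib_left mult_ac)
    qed
    ultimately show ?thesis by blast
  next
    case square
    then have p': "p = (k - 1) * (n - 1) + (2 * n - 6)" using shift by simp
    have "realizable n p ((k - 1) * ((n - 1) choose 2) + (n - 3) * (n - 3))"
      unfolding p' using n by (intro realizable_blocks realizable_bipartite)
    moreover have "2 * ((n - 3) * (n - 3)) + 2 * (n - 3) = (n - 2) * (2 * n - 6)"
    proof -
      have "3 \<le> n" using n by simp
      then obtain m where "n = 3 + m" using le_Suc_ex by blast
      then show ?thesis by (simp add: algebra_simps)
    qed
    then have "2 * ((k - 1) * ((n - 1) choose 2) + (n - 3) * (n - 3)) + gap n p = (n - 2) * p"
      unfolding gap square(2) distrib_left mult.left_commute[of 2 "k - 1"] choose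
      by (simp only: p' distrib_left mult_ac add_ac)
    ultimately show ?thesis by blast
  next
    case plus
    then have p': "p = (k - 1) * (n - 1) + 13" using shift by simp
    have "realizable n p ((k - 1) * ((n - 1) choose 2) + 43)"
      unfolding p' using plus realizable_bipartite_plus_edge by (intro realizable_blocks) auto
    moreover have "2 * ((k - 1) * ((n - 1) choose 2) + 43) + gap n p = (n - 2) * p"
      unfolding gap distrib_left mult.left_commute[of 2 "k - 1"] choose
      by (simp add: p' plus loss_def)
    ultimately show ?thesis by blast
  qed
qed

section \<open>The extremal number\<close>

lemma turan_number_T_star:
  assumes n: "6 \<le> n" "n \<le> 10" and p: "n \<le> p"
  shows "2 * turan_number p (T_star n) + loss n (p mod (n - 1)) = (n - 2) * p"
proof -
  obtain e where e: "realizable n p e" "2 * e + gap n p = (n - 2) * p"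
    using realizable_extremal[OF assms] by blast
  obtain E where E: "E \<subseteq> nsets {..<p} 2" "card E = e" "\<not> has_spider n E"
    using e(1) unfolding realizable_def by blast
  have "simple_graph ({..<p}, E)" using E(1) by (simp add: simple_graph_def verts_def edges_def)
  moreover from this have "\<not> contains_subgraph ({..<p}, E) (T_star n)"
    using has_spider_if_contains[OF _ n(1)] E(3) by (fastforce simp: edges_def)
  ultimately have mem: "e \<in> {card (edges G) | G :: nat graph.
      simple_graph G \<and> card (verts G) = p \<and> \<not> contains_subgraph G (T_star n)}"
    using E(2) by (intro CollectI exI[of _ "({..<p}, E)"]) (simp add: verts_def edges_def)
  have "turan_number p (T_star n) = e"
    unfolding turan_number_def
  proof (rule Max_eqI[OF finite_turan_set _ mem])
    fix y assume "y \<in> {card (edges G) | G :: nat graph.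
      simple_graph G \<and> card (verts G) = p \<and> \<not> contains_subgraph G (T_star n)}"
    then obtain G :: "nat graph" where "y = card (edges G)" "simple_graph G" "card (verts G) = p"
      "\<not> contains_subgraph G (T_star n)" by blast
    then show "y \<le> e" using card_edges_le[OF n, of G] e(2) by simp
  qed
  then show ?thesis using e(2) p by (simp add: gap_def)
qed

theorem theorem4p5:
  fixes p n r :: nat
  assumes "6 \<le> n" and "n \<le> 10" and "p \<ge> n"
    and "r \<in> {0..n - 2}" and "[p = r] (mod (n - 1))"
  shows "(n \<in> {6, 7} \<longrightarrow>
            real (turan_number p (T_star n))
              = ((real n - 2) * real p - real r * (real n - 1 - real r)) / 2)
       \<and> (n \<in> {8, 9} \<longrightarrow>
            real (turan_number p (T_star n))
              = (if r \<noteq> n - 5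
                 then ((real n - 2) * real p - real r * (real n - 1 - real r)) / 2
                 else (real n - 2) * (real p - 2) / 2 + 1))
       \<and> (n = 10 \<longrightarrow>
            real (turan_number p (T_star n))
              = (if r = 5 then 4 * real p - 7
                 else if r = 4 then 4 * real p - 9
                 else 4 * real p - real r * (9 - real r) / 2))"
proof -
  have r: "r < n - 1" using assms(1,4) by auto
  then have "p mod (n - 1) = r" using assms(5) by (simp add: cong_def)
  then have "real (2 * turan_number p (T_star n) + loss n r) = real ((n - 2) * p)"
    using turan_number_T_star[OF assms(1-3)] by simp
  then have T: "2 * real (turan_number p (T_star n)) = (real n - 2) * real p - real (loss n r)"
    using assms(1) by (simp add: of_nat_diff)
  have product: "real (r * (n - 1 - r)) = real r * (real n - 1 - real r)"
    using r by (simp add: of_nat_diff)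
  have "n = 6 \<or> n = 7 \<or> n = 8 \<or> n = 9 \<or> n = 10" using assms(1,2) by linarith
  then show ?thesis
    \<comment> \<open>For n = 8 or 9 and r = n - 5 the loss 2 * n - 6 equals 2 * (n - 2) - 2, which
      gives the factor p - 2 and the summand 1.\<close>
    using T product by (elim disjE) (auto simp: loss_def field_simps)
qed

end
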